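(* Let $a, b \in \mathbb{N}$. Let $H$ be any connected graph of order $a$, let $\Gamma$ be any permutation group on $V(H)$, and let $\Lambda$ be the trivial permutation group on $V(P^{\mathrm{mon}}_b)$, where $P^{\mathrm{mon}}_b$ is the monotone path of order $b$. Then the permutational Ramsey number satisfies $$R\left(H^\Gamma, (P_b^{\mathrm{mon}})^\Lambda\right) = 1 + (a-1)(b-1).$$
   Context: $\mathbb{N}=\{1,2,3,\ldots\}$. All graphs are undirected, simple and finite, with vertex set $\{0,1,\ldots,n-1\}$ for some $n\in\mathbb{N}$; $V(G)$ and $E(G)$ denote the vertex and edge sets of $G$, and $|G|$ its order (number of vertices). $K_n$ is the complete graph on $n$ vertices. A $k$-edge-coloring of a graph is a map from its edge set to $\{1,\ldots,k\}$. For graphs $G,H$ and a permutation group $\Gamma$ on $V(H)$, $H$ is $\Gamma$-embeddable in $G$ if there is a graph homomorphism from $H$ to $G$ of the form $\psi\circ\varphi$, where $\varphi\in\Gamma$ and $\psi\colon V(H)\to V(G)$ is an increasing injection. For graphs $H_1,\ldots,H_k$ and permutation groups $\Gamma_1,\ldots,\Gamma_k$ on their respective vertex sets, the permutational Ramsey number $R(H_1^{\Gamma_1},\ldots,H_k^{\Gamma_k})$ is the minimum $n\in\mathbb{N}$ such that for every $k$-edge-coloring of $K_n$ there is some $j\in\{1,\ldots,k\}$ for which $H_j$ is $\Gamma_j$-embeddable in the spanning subgraph of $K_n$ comprising the edges of color $j$. For $n\in\mathbb{N}$, the monotone path $P^{\mathrm{mon}}_n$ is the graph of order $n$ in which two vertices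 are adjacent if and only if they are consecutive integers. *)

theory Defs
  imports "HOL-Algebra.Bij" "HOL-Library.Ramsey"
begin

text \<open>A graph is given by its order \<open>n\<close> and its set of edges, each an unordered pair of distinct
  vertices from \<open>{0, \<dots>, n - 1}\<close>. The order is required to be positive.\<close>

record ngraph =
  gorder :: nat
  gedges :: "nat set set"

definition gverts :: "ngraph \<Rightarrow> nat set" where
  "gverts G = {..<gorder G}"

definition is_graph :: "ngraph \<Rightarrow> bool" where
  "is_graph G \<longleftrightarrow> gorder G \<ge> 1 \<and> gedges G \<subseteq> [gverts G]\<^bsup>2\<^esup>"

definition connected_graph :: "ngraph \<Rightarrow> bool" where
  "connected_graph G \<longleftrightarrow>
     (\<forall>u\<in>gverts G. \<forall>v\<in>gverts G. (u, v) \<in> {(x, y). {x, y} \<in> gedges G}\<^sup>*)"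

definition complete_graph :: "nat \<Rightarrow> ngraph" where
  "complete_graph n = \<lparr>gorder = n, gedges = [{..<n}]\<^bsup>2\<^esup>\<rparr>"

definition mono_path :: "nat \<Rightarrow> ngraph" where
  "mono_path n = \<lparr>gorder = n, gedges = {{i, Suc i} | i. Suc i < n}\<rparr>"

definition graph_hom :: "ngraph \<Rightarrow> ngraph \<Rightarrow> (nat \<Rightarrow> nat) \<Rightarrow> bool" where
  "graph_hom H G f \<longleftrightarrow> f \<in> gverts H \<rightarrow> gverts G \<and>
     (\<forall>u v. {u, v} \<in> gedges H \<longrightarrow> {f u, f v} \<in> gedges G)"

text \<open>Permutations of \<open>V(H)\<close> are the elements of \<^term>\<open>BijGroup (gverts H)\<close>, so they are
  extensional functions; their value outside \<open>V(H)\<close> plays no role.\<close>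

definition perm_group_on :: "nat set \<Rightarrow> (nat \<Rightarrow> nat) set \<Rightarrow> bool" where
  "perm_group_on V \<Gamma> \<longleftrightarrow> subgroup \<Gamma> (BijGroup V)"

definition trivial_perm_group :: "nat set \<Rightarrow> (nat \<Rightarrow> nat) set" where
  "trivial_perm_group V = {\<one>\<^bsub>BijGroup V\<^esub>}"

definition embeddable :: "ngraph \<Rightarrow> (nat \<Rightarrow> nat) set \<Rightarrow> ngraph \<Rightarrow> bool" where
  "embeddable H \<Gamma> G \<longleftrightarrow>
     (\<exists>\<phi>\<in>\<Gamma>. \<exists>\<psi>. \<psi> \<in> gverts H \<rightarrow> gverts G \<and> strict_mono_on (gverts H) \<psi> \<and>
        graph_hom H G (\<psi> \<circ> \<phi>))"

definition edge_coloring :: "nat \<Rightarrow> ngraph \<Rightarrow> (nat set \<Rightarrow> nat) \<Rightarrow> bool" where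
  "edge_coloring k G c \<longleftrightarrow> c \<in> gedges G \<rightarrow> {1..k}"

definition color_subgraph :: "ngraph \<Rightarrow> (nat set \<Rightarrow> nat) \<Rightarrow> nat \<Rightarrow> ngraph" where
  "color_subgraph G c j = \<lparr>gorder = gorder G, gedges = {e \<in> gedges G. c e = j}\<rparr>"

text \<open>The pairs \<open>(H\<^sub>1, \<Gamma>\<^sub>1), \<dots>, (H\<^sub>k, \<Gamma>\<^sub>k)\<close> form a list. Colors are \<open>1, \<dots>, k\<close> while list
  positions start at 0.\<close>

definition ramsey_arrow :: "nat \<Rightarrow> (ngraph \<times> (nat \<Rightarrow> nat) set) list \<Rightarrow> bool" where
  "ramsey_arrow n Hs \<longleftrightarrow>
     (\<forall>c. edge_coloring (length Hs) (complete_graph n) c \<longrightarrow>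
       (\<exists>j\<in>{1..length Hs}.
          embeddable (fst (Hs ! (j - 1))) (snd (Hs ! (j - 1)))
            (color_subgraph (complete_graph n) c j)))"

definition perm_ramsey :: "(ngraph \<times> (nat \<Rightarrow> nat) set) list \<Rightarrow> nat" where
  "perm_ramsey Hs = (LEAST n. n \<ge> 1 \<and> ramsey_arrow n Hs)"

text \<open>The minimum in the definition of \<^const>\<open>perm_ramsey\<close> is attained, by Ramsey's theorem.\<close>

lemma ex_ramsey_arrow:
  assumes Hs: "\<And>H \<Gamma>. (H, \<Gamma>) \<in> set Hs \<Longrightarrow> is_graph H \<and> perm_group_on (gverts H) \<Gamma>"
  shows "\<exists>n\<ge>1. ramsey_arrow n Hs"
proof -
  let ?q = "map (gorder \<circ> fst) Hs"
  obtain N where N: "partn_lst {..<N::nat} ?q 2"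
    using ramsey_full by blast
  have pos: "gorder (fst (Hs ! i)) \<ge> 1" if "i < length Hs" for i
    using Hs[of "fst (Hs ! i)" "snd (Hs ! i)"] that by (simp add: is_graph_def)
  have "ramsey_arrow N Hs"
    unfolding ramsey_arrow_def
  proof (intro allI impI)
    fix c assume "edge_coloring (length Hs) (complete_graph N) c"
    then have c: "c e \<in> {1..length Hs}" if "e \<in> [{..<N}]\<^bsup>2\<^esup>" for e
      using that by (auto simp: edge_coloring_def complete_graph_def)
    then have "(\<lambda>e. c e - 1) \<in> [{..<N}]\<^bsup>2\<^esup> \<rightarrow> {..<length ?q}"
      by fastforce
    then obtain i M where i: "i < length Hs" and M: "M \<in> nsets {..<N} (?q ! i)"
      and mono: "(\<lambda>e. c e - 1) ` [M]\<^bsup>2\<^esup> \<subseteq> {i}"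
      using N unfolding partn_lst_def monochromatic_def by (metis length_map)
    define H where "H = fst (Hs ! i)"
    define \<Gamma> where "\<Gamma> = snd (Hs ! i)"
    have H: "is_graph H" "perm_group_on (gverts H) \<Gamma>"
      using Hs[of H \<Gamma>] i by (simp_all add: H_def \<Gamma>_def)
    have MN: "M \<subseteq> {..<N}" "finite M" "card M = gorder H"
      using M i by (auto simp: nsets_def H_def)
    obtain \<psi> where \<psi>: "bij_betw \<psi> {..<gorder H} M" "strict_mono_on {..<gorder H} \<psi>"
      using ex_bij_betw_strict_mono_card[OF MN(2)] MN(3) by metis
    let ?G = "color_subgraph (complete_graph N) c (Suc i)"
    let ?id = "\<lambda>x\<in>gverts H. x"
    have "?id \<in> \<Gamma>"
      using subgroup.one_closed[OF H(2)[unfolded perm_group_on_def]] by (simp add: BijGroup_def)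
    moreover have \<psi>M: "\<psi> x \<in> M" if "x \<in> gverts H" for x
      using \<psi>(1) that by (auto simp: gverts_def bij_betw_def)
    then have "\<psi> \<in> gverts H \<rightarrow> gverts ?G"
      using MN(1) by (auto simp: gverts_def color_subgraph_def complete_graph_def)
    moreover have "graph_hom H ?G (\<psi> \<circ> ?id)"
      unfolding graph_hom_def
    proof (intro conjI allI impI)
      show "\<psi> \<circ> ?id \<in> gverts H \<rightarrow> gverts ?G"
        using calculation(2) by auto
      fix u v assume "{u, v} \<in> gedges H"
      then have uv: "u \<in> gverts H" "v \<in> gverts H" "u \<noteq> v"
        using H(1) by (auto simp: is_graph_def nsets_def)
      then have "\<psi> u \<noteq> \<psi> v"
        using \<psi>(1) by (auto simp: gverts_def bij_betw_def inj_on_def)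
      then have e: "{\<psi> u, \<psi> v} \<in> [M]\<^bsup>2\<^esup>"
        using \<psi>M uv by (auto simp: nsets_def)
      then have eN: "{\<psi> u, \<psi> v} \<in> [{..<N}]\<^bsup>2\<^esup>"
        using MN(1) by (auto simp: nsets_def)
      have "c {\<psi> u, \<psi> v} - 1 = i"
        using mono e by blast
      then have "c {\<psi> u, \<psi> v} = Suc i"
        using c[OF eN] by auto
      then show "{(\<psi> \<circ> ?id) u, (\<psi> \<circ> ?id) v} \<in> gedges ?G"
        using eN uv by (simp add: color_subgraph_def complete_graph_def)
    qed
    ultimately have "embeddable H \<Gamma> ?G"
      using \<psi>(2) unfolding embeddable_def by (auto simp: gverts_def)
    then show "\<exists>j\<in>{1..length Hs}. embeddable (fst (Hs ! (j - 1))) (snd (Hs ! (j - 1)))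
        (color_subgraph (complete_graph N) c j)"
      using i by (intro bexI[of _ "Suc i"]) (auto simp: H_def \<Gamma>_def)
  qed
  moreover have "N \<ge> 1"
  proof (rule ccontr)
    assume "\<not> N \<ge> 1"
    then have "{..<N} = {}"
      by auto
    then have "partn_lst ({}::nat set) ?q 2"
      using N by metis
    moreover have "(\<lambda>_. 0) \<in> [{}::nat set]\<^bsup>2\<^esup> \<rightarrow> {..<length ?q}"
      by (auto simp: nsets_def)
    ultimately obtain i where i: "i < length Hs" "nsets ({}::nat set) (?q ! i) \<noteq> {}"
      unfolding partn_lst_def monochromatic_def by (metis empty_iff length_map)
    then show False
      using pos[OF i(1)] by (auto simp: nsets_def)
  qed
  ultimately show ?thesis by blast
qed

end

theory Submission
  imports Defs
begin

text \<open>
  Write \<open>m = a - 1\<close> and \<open>n = b - 1\<close>; the claim is that a complete graph has a coloring that avoids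
  both graphs if and only if its order is at most \<open>m * n\<close>.

  Lower bound: cut \<open>{0, \<dots>, m * n - 1}\<close> into \<open>n\<close> consecutive blocks of size \<open>m\<close> and use color 1
  inside the blocks and color 2 between them. A connected graph in color 1 stays in one block
  (\<open>connected_map_const\<close>), which is too small for the \<open>m + 1\<close> distinct images of the vertices of
  \<open>H\<close>. A monotone path in color 2 enters a later block at each step
  (\<open>index_le_of_increasing_steps\<close>), and there are too few blocks for \<open>n + 1\<close> vertices. The
  answer does not depend on \<open>\<Gamma>\<close> because the argument about \<open>H\<close> only sees that the vertex map is
  injective, and a permutation of \<open>V(H)\<close> preserves this.

  Upper bound: on more than \<open>m * n\<close> vertices, peeling off the vertices with no outgoing color 2
  edge to a larger vertex, up to \<open>n\<close> times, gives either a layer of more than \<open>m\<close> vertices or an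
  increasing path with \<open>n + 1\<close> vertices in color 2 (\<open>independent_set_or_chain\<close>). A layer has no
  edge of color 2, so it is a clique of color 1, in which every graph of order \<open>m + 1\<close> embeds, using
  the identity of \<open>\<Gamma>\<close> (\<open>embeddable_in_clique\<close>).
\<close>

section \<open>Independent sets and chains\<close>

text \<open>Mirsky's theorem for an arbitrary relation, where only consecutive elements of a chain are
  related. The induction is on \<open>n\<close>: the elements of \<open>S\<close> with no \<open>R\<close>-successor above them in \<open>S\<close> form an
  independent set, so if there are at most \<open>m\<close> of them, the rest of \<open>S\<close> is large enough for a
  chain that is one shorter; its last element has a successor in \<open>S\<close>, which extends it.\<close>

lemma independent_set_or_chain:
  fixes S :: "'a::linorder set"
  assumes "finite S" and "m * n < card S"
  shows "(\<exists>T\<subseteq>S. m < card T \<and> (\<forall>u\<in>T. \<forall>v\<in>T. u < v \<longrightarrow> \<not> R u v)) \<or>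
    (\<exists>p. (\<forall>i\<le>n. p i \<in> S) \<and> (\<forall>i<n. p i < p (Suc i) \<and> R (p i) (p (Suc i))))"
  using assms
proof (induction n arbitrary: S)
  case 0
  then obtain x where "x \<in> S"
    by fastforce
  then show ?case
    by (intro disjI2 exI[of _ "\<lambda>_. x"]) simp
next
  case (Suc n)
  define T where "T = {u \<in> S. \<forall>v\<in>S. u < v \<longrightarrow> \<not> R u v}"
  have T: "T \<subseteq> S" "\<forall>u\<in>T. \<forall>v\<in>T. u < v \<longrightarrow> \<not> R u v"
    by (auto simp: T_def)
  show ?case
  proof (cases "m < card T")
    case True
    then show ?thesis
      using T by blast
  next
    case False
    have "card (S - T) = card S - card T"
      using T(1) Suc.prems(1) by (meson card_Diff_subset finite_subset)
    then have "m * n < card (S - T)"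
      using False Suc.prems(2) by simp
    with Suc.IH[of "S - T"] Suc.prems(1) consider
        (indep) U where "U \<subseteq> S - T" "m < card U" "\<forall>u\<in>U. \<forall>v\<in>U. u < v \<longrightarrow> \<not> R u v"
      | (chain) p where "\<forall>i\<le>n. p i \<in> S - T" "\<forall>i<n. p i < p (Suc i) \<and> R (p i) (p (Suc i))"
      by auto
    then show ?thesis
    proof cases
      case indep
      then show ?thesis
        by blast
    next
      case chain
      then have "p n \<in> S" "p n \<notin> T"
        by auto
      then obtain w where w: "w \<in> S" "p n < w" "R (p n) w"
        by (auto simp: T_def)
      have "(\<forall>i\<le>Suc n. (p(Suc n := w)) i \<in> S) \<and>
        (\<forall>i<Suc n. (p(Suc n := w)) i < (p(Suc n := w)) (Suc i) \<and>
          R ((p(Suc n := w)) i) ((p(Suc n := w)) (Suc i)))"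
        using chain w by (auto simp: less_Suc_eq le_Suc_eq)
      then show ?thesis
        by blast
    qed
  qed
qed

section \<open>Embeddings\<close>

text \<open>The identity of the permutation group and the increasing enumeration of \<open>T\<close> form an
  embedding, because inside a clique every injective map preserves edges.\<close>

lemma embeddable_in_clique:
  assumes H: "is_graph H" and \<Gamma>: "perm_group_on (gverts H) \<Gamma>"
    and T: "T \<subseteq> gverts G" "card T = gorder H"
    and clique: "\<And>u v. u \<in> T \<Longrightarrow> v \<in> T \<Longrightarrow> u \<noteq> v \<Longrightarrow> {u, v} \<in> gedges G"
  shows "embeddable H \<Gamma> G"
proof -
  have "finite T"
    using T(1) by (auto simp: gverts_def intro: finite_subset)
  then obtain \<psi> where bij: "bij_betw \<psi> (gverts H) T" and mono: "strict_mono_on (gverts H) \<psi>"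
    using ex_bij_betw_strict_mono_card[of T] T(2) by (metis gverts_def)
  let ?id = "\<lambda>x\<in>gverts H. x"
  have "?id \<in> \<Gamma>"
    using subgroup.one_closed[OF \<Gamma>[unfolded perm_group_on_def]] by (simp add: BijGroup_def)
  moreover have \<psi>: "\<psi> x \<in> T" if "x \<in> gverts H" for x
    using bij that by (auto simp: bij_betw_def)
  moreover have "{\<psi> u, \<psi> v} \<in> gedges G" "u \<in> gverts H" "v \<in> gverts H"
    if "{u, v} \<in> gedges H" for u v
  proof -
    show uv: "u \<in> gverts H" "v \<in> gverts H"
      using H that by (auto simp: is_graph_def nsets_def)
    moreover have "u \<noteq> v"
      using H that by (auto simp: is_graph_def nsets_def)
    ultimately have "\<psi> u \<noteq> \<psi> v"
      using bij by (auto simp: bij_betw_def inj_on_def)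
    then show "{\<psi> u, \<psi> v} \<in> gedges G"
      using clique \<psi> uv by blast
  qed
  ultimately show ?thesis
    using T(1) mono unfolding embeddable_def graph_hom_def
    by (intro bexI[of _ ?id] exI[of _ \<psi>]) auto
qed

text \<open>Increasing at each step is enough for \<open>p\<close> to be increasing, and the only permutation in
  use is the identity, so an embedded monotone path is a chain as in
  \<open>independent_set_or_chain\<close>.\<close>

lemma embeddable_mono_path_iff:
  "embeddable (mono_path (Suc n)) (trivial_perm_group (gverts (mono_path (Suc n)))) G \<longleftrightarrow>
    (\<exists>p. (\<forall>i\<le>n. p i \<in> gverts G) \<and> (\<forall>i<n. p i < p (Suc i) \<and> {p i, p (Suc i)} \<in> gedges G))"
    (is "?L \<longleftrightarrow> ?R")
proof
  assume ?L
  then obtain \<psi> where \<psi>: "\<psi> \<in> {..<Suc n} \<rightarrow> gverts G" "strict_mono_on {..<Suc n} \<psi>"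
    and hom: "graph_hom (mono_path (Suc n)) G (\<psi> \<circ> (\<lambda>x\<in>{..<Suc n}. x))"
    by (auto simp: embeddable_def trivial_perm_group_def BijGroup_def gverts_def mono_path_def)
  have "\<psi> i < \<psi> (Suc i) \<and> {\<psi> i, \<psi> (Suc i)} \<in> gedges G" if "i < n" for i
  proof
    show "\<psi> i < \<psi> (Suc i)"
      using \<psi>(2) that by (simp add: strict_mono_on_def)
    have "{i, Suc i} \<in> gedges (mono_path (Suc n))"
      using that by (auto simp: mono_path_def)
    then have "{(\<psi> \<circ> (\<lambda>x\<in>{..<Suc n}. x)) i, (\<psi> \<circ> (\<lambda>x\<in>{..<Suc n}. x)) (Suc i)} \<in> gedges G"
      using hom unfolding graph_hom_def by blast
    then show "{\<psi> i, \<psi> (Suc i)} \<in> gedges G"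
      using that by simp
  qed
  then show ?R
    using \<psi>(1) by (intro exI[of _ \<psi>]) (simp add: Pi_iff less_Suc_eq_le)
next
  assume ?R
  then obtain p where p: "\<forall>i\<le>n. p i \<in> gverts G"
    and step: "\<forall>i<n. p i < p (Suc i) \<and> {p i, p (Suc i)} \<in> gedges G"
    by blast
  have less: "p i < p j" if "i < j" "j \<le> n" for i j
    using that
  proof (induction j)
    case (Suc j)
    then show ?case
      using step by (metis Suc_le_eq less_Suc_eq less_imp_le_nat order_less_trans)
  qed simp
  have "{p u, p v} \<in> gedges G" "u \<le> n" "v \<le> n" if "{u, v} \<in> gedges (mono_path (Suc n))" for u v
  proof -
    have "\<exists>i. {u, v} = {i, Suc i} \<and> i < n"
      using that by (simp add: mono_path_def)
    then obtain i where i: "{u, v} = {i, Suc i}" "i < n"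
      by (elim exE conjE)
    have "p ` {u, v} = {p i, p (Suc i)}"
      by (simp only: i(1) image_insert image_empty)
    then show "{p u, p v} \<in> gedges G"
      using step i(2) by simp
    have "{u, v} \<subseteq> {..n}"
      by (subst i(1)) (use i(2) in simp)
    then show "u \<le> n" "v \<le> n"
      by simp_all
  qed
  note edge = this
  let ?V = "gverts (mono_path (Suc n))"
  have V: "?V = {..n}"
    by (auto simp: gverts_def mono_path_def)
  have "p \<in> ?V \<rightarrow> gverts G" "strict_mono_on ?V p"
    using p less by (auto simp: V strict_mono_on_def)
  moreover have "graph_hom (mono_path (Suc n)) G (p \<circ> (\<lambda>x\<in>?V. x))"
    using p edge by (simp add: graph_hom_def V)
  moreover have "(\<lambda>x\<in>?V. x) \<in> trivial_perm_group ?V"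
    by (simp add: trivial_perm_group_def BijGroup_def)
  ultimately show ?L
    unfolding embeddable_def by blast
qed

section \<open>The block coloring\<close>

lemma connected_map_const:
  assumes "connected_graph H" "u \<in> gverts H" "v \<in> gverts H"
    and edge: "\<And>x y. {x, y} \<in> gedges H \<Longrightarrow> f x = f y"
  shows "f u = f v"
proof -
  have "(u, v) \<in> {(x, y). {x, y} \<in> gedges H}\<^sup>*"
    using assms(1-3) by (simp add: connected_graph_def)
  then show ?thesis
    by (induction rule: rtrancl_induct) (auto dest: edge)
qed

lemma index_le_of_increasing_steps:
  fixes f :: "nat \<Rightarrow> nat"
  assumes "\<And>i. i < n \<Longrightarrow> f i < f (Suc i)"
  shows "n \<le> f n"
  using assms
proof (induction n)
  case (Suc n)
  then have "n \<le> f n" "f n < f (Suc n)"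
    by simp_all
  then show ?case
    by simp
qed simp

text \<open>The color of an edge is the number of blocks that it meets, so color 1 means that the edge
  is inside a block.\<close>

definition block_coloring :: "nat \<Rightarrow> nat set \<Rightarrow> nat" where
  "block_coloring m e = card ((\<lambda>v. v div m) ` e)"

lemma block_coloring_edge:
  "block_coloring m {u, v} = (if u div m = v div m then 1 else 2)"
  by (simp add: block_coloring_def)

lemma edge_coloring_block_coloring:
  "edge_coloring 2 (complete_graph N) (block_coloring m)"
  by (auto simp: edge_coloring_def complete_graph_def nsets_def card_2_iff block_coloring_edge)

text \<open>The map \<open>\<psi> \<circ> \<phi>\<close> sends the connected graph \<open>H\<close> injectively into a single block, whose \<open>m\<close>
  elements are too few.\<close>

lemma not_embeddable_block_coloring_1:
  assumes conn: "connected_graph H" and \<Gamma>: "perm_group_on (gverts H) \<Gamma>"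
    and m: "0 < m" "m < gorder H"
  shows "\<not> embeddable H \<Gamma> (color_subgraph (complete_graph N) (block_coloring m) 1)"
proof
  assume "embeddable H \<Gamma> (color_subgraph (complete_graph N) (block_coloring m) 1)"
  then obtain \<phi> \<psi> where \<phi>: "\<phi> \<in> \<Gamma>" and \<psi>: "strict_mono_on (gverts H) \<psi>"
    and hom: "graph_hom H (color_subgraph (complete_graph N) (block_coloring m) 1) (\<psi> \<circ> \<phi>)"
    unfolding embeddable_def by blast
  let ?f = "\<psi> \<circ> \<phi>"
  have "\<phi> \<in> Bij (gverts H)"
    using \<phi> \<Gamma> subgroup.subset unfolding perm_group_on_def BijGroup_def by fastforce
  then have "bij_betw \<phi> (gverts H) (gverts H)"
    by (simp add: Bij_def)
  then have inj: "inj_on ?f (gverts H)"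
    using \<psi> by (simp add: bij_betw_def comp_inj_on strict_mono_on_imp_inj_on)
  have edge: "?f x div m = ?f y div m" if "{x, y} \<in> gedges H" for x y
  proof -
    have "{?f x, ?f y} \<in> gedges (color_subgraph (complete_graph N) (block_coloring m) 1)"
      using hom that unfolding graph_hom_def by blast
    then have "block_coloring m {?f x, ?f y} = 1"
      by (simp add: color_subgraph_def)
    then show ?thesis
      by (simp add: block_coloring_edge split: if_splits)
  qed
  define q where "q = ?f 0 div m"
  have "0 \<in> gverts H"
    using m by (simp add: gverts_def)
  then have block: "?f x div m = q" if "x \<in> gverts H" for x
    unfolding q_def by (rule connected_map_const[OF conn that, of 0 "\<lambda>x. ?f x div m"]) (rule edge)
  have "?f ` gverts H \<subseteq> {q * m..<q * m + m}"
  proof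
    fix y assume "y \<in> ?f ` gverts H"
    then have "y div m = q"
      using block by blast
    then have "q * m \<le> y" "y < q * m + m"
      using m(1) dividend_less_div_times[of m y] by auto
    then show "y \<in> {q * m..<q * m + m}"
      by simp
  qed
  then have "card (?f ` gverts H) \<le> card {q * m..<q * m + m}"
    by (intro card_mono) simp_all
  moreover have "card (?f ` gverts H) = gorder H"
    using card_image[OF inj] by (simp add: gverts_def)
  ultimately show False
    using m(2) by simp
qed

text \<open>Block indices strictly increase along the path, so its last vertex would lie in a block of
  index at least \<open>n\<close>, beyond the vertices of the complete graph.\<close>

lemma not_embeddable_block_coloring_2:
  assumes "N \<le> m * n"
  shows "\<not> embeddable (mono_path (Suc n)) (trivial_perm_group (gverts (mono_path (Suc n))))
    (color_subgraph (complete_graph N) (block_coloring m) 2)"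
proof
  assume "embeddable (mono_path (Suc n)) (trivial_perm_group (gverts (mono_path (Suc n))))
    (color_subgraph (complete_graph N) (block_coloring m) 2)"
  then obtain p where p: "p n < N"
    and step: "\<And>i. i < n \<Longrightarrow> p i < p (Suc i) \<and> block_coloring m {p i, p (Suc i)} = 2"
    unfolding embeddable_mono_path_iff
    by (auto simp: gverts_def color_subgraph_def complete_graph_def)
  have "p i div m < p (Suc i) div m" if "i < n" for i
  proof -
    have "p i div m \<noteq> p (Suc i) div m"
      using step[OF that] by (auto simp: block_coloring_edge split: if_splits)
    moreover have "p i div m \<le> p (Suc i) div m"
      using step[OF that] by (intro div_le_mono) simp
    ultimately show ?thesis
      by simp
  qed
  then have "n \<le> p n div m"
    by (rule index_le_of_increasing_steps)
  moreover have "p n div m < n"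
    using p assms by (intro less_mult_imp_div_less) (simp add: mult.commute)
  ultimately show False
    by simp
qed

section \<open>The Ramsey number\<close>

lemma ramsey_arrow_pair_iff:
  "ramsey_arrow N [(H, \<Gamma>), (K, \<Lambda>)] \<longleftrightarrow>
    (\<forall>c. edge_coloring 2 (complete_graph N) c \<longrightarrow>
      embeddable H \<Gamma> (color_subgraph (complete_graph N) c 1) \<or>
      embeddable K \<Lambda> (color_subgraph (complete_graph N) c 2))"
proof -
  have "length [(H, \<Gamma>), (K, \<Lambda>)] = 2"
    by simp
  moreover have "(\<exists>j\<in>{1..2}. P j) \<longleftrightarrow> P 1 \<or> P 2" for P :: "nat \<Rightarrow> bool"
    by (auto simp: Bex_def le_Suc_eq numeral_2_eq_2)
  ultimately show ?thesis
    unfolding ramsey_arrow_def by (simp only:) simp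
qed

lemma ramsey_arrow_graph_mono_path:
  assumes H: "is_graph H" "gorder H = Suc m" and \<Gamma>: "perm_group_on (gverts H) \<Gamma>"
    and N: "m * n < N"
  shows "ramsey_arrow N
    [(H, \<Gamma>), (mono_path (Suc n), trivial_perm_group (gverts (mono_path (Suc n))))]"
  unfolding ramsey_arrow_pair_iff
proof (intro allI impI)
  fix c assume c: "edge_coloring 2 (complete_graph N) c"
  let ?G = "\<lambda>j. color_subgraph (complete_graph N) c j"
  have edge: "{u, v} \<in> gedges (?G j) \<longleftrightarrow> u < N \<and> v < N \<and> u \<noteq> v \<and> c {u, v} = j" for u v j
    by (auto simp: color_subgraph_def complete_graph_def nsets_def card_insert_if)
  have verts: "gverts (?G j) = {..<N}" for j
    by (simp add: gverts_def color_subgraph_def complete_graph_def)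
  consider
      (indep) T where "T \<subseteq> {..<N}" "m < card T" "\<forall>u\<in>T. \<forall>v\<in>T. u < v \<longrightarrow> c {u, v} \<noteq> 2"
    | (chain) p where "\<forall>i\<le>n. p i \<in> {..<N}" "\<forall>i<n. p i < p (Suc i) \<and> c {p i, p (Suc i)} = 2"
    using independent_set_or_chain[of "{..<N}" m n "\<lambda>u v. c {u, v} = 2"] N by auto
  then show "embeddable H \<Gamma> (?G 1) \<or> embeddable (mono_path (Suc n))
    (trivial_perm_group (gverts (mono_path (Suc n)))) (?G 2)"
  proof cases
    case indep
    then obtain U where U: "U \<subseteq> T" "card U = Suc m"
      by (meson Suc_leI obtain_subset_with_card_n)
    have "{u, v} \<in> gedges (?G 1)" if uv: "u \<in> U" "v \<in> U" "u \<noteq> v" for u v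
    proof -
      have N: "u < N" "v < N"
        using uv U(1) indep(1) by auto
      then have "{u, v} \<in> gedges (complete_graph N)"
        using uv(3) by (auto simp: complete_graph_def nsets_def)
      then have "c {u, v} \<in> {1..2}"
        using c unfolding edge_coloring_def by blast
      moreover have "c {u, v} \<noteq> 2"
        using uv U(1) indep(3) by (metis insert_commute linorder_neqE_nat subsetD)
      ultimately show ?thesis
        using edge N uv(3) by auto
    qed
    then have "embeddable H \<Gamma> (?G 1)"
      using embeddable_in_clique[OF H(1) \<Gamma>, of U "?G 1"] U indep(1) H(2) verts by auto
    then show ?thesis ..
  next
    case chain
    then have "embeddable (mono_path (Suc n))
      (trivial_perm_group (gverts (mono_path (Suc n)))) (?G 2)"
      unfolding embeddable_mono_path_iff edge verts
      by (intro exI[of _ p]) fastforce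
    then show ?thesis ..
  qed
qed

lemma not_ramsey_arrow_connected_mono_path:
  assumes "connected_graph H" "gorder H = Suc m" "perm_group_on (gverts H) \<Gamma>"
    and N: "1 \<le> N" "N \<le> m * n"
  shows "\<not> ramsey_arrow N
    [(H, \<Gamma>), (mono_path (Suc n), trivial_perm_group (gverts (mono_path (Suc n))))]"
proof -
  have "0 < m"
    using N by (cases m) auto
  then have "\<not> embeddable H \<Gamma> (color_subgraph (complete_graph N) (block_coloring m) 1)"
    using assms(2) by (intro not_embeddable_block_coloring_1[OF assms(1,3)]) simp_all
  then show ?thesis
    unfolding ramsey_arrow_pair_iff
    using edge_coloring_block_coloring[of N m] not_embeddable_block_coloring_2[OF N(2)]
    by blast
qed

theorem theorem4p1:
  fixes a b :: nat and H :: ngraph and \<Gamma> \<Lambda> :: "(nat \<Rightarrow> nat) set"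
  assumes "a \<ge> 1" and "b \<ge> 1"
    and "is_graph H" and "connected_graph H" and "gorder H = a"
    and "perm_group_on (gverts H) \<Gamma>"
    and "\<Lambda> = trivial_perm_group (gverts (mono_path b))"
  shows "perm_ramsey [(H, \<Gamma>), (mono_path b, \<Lambda>)] = 1 + (a - 1) * (b - 1)"
proof -
  obtain m n where mn: "a = Suc m" "b = Suc n"
    using assms(1,2) by (metis Suc_le_D One_nat_def)
  show ?thesis
    unfolding perm_ramsey_def assms(7) mn
  proof (rule Least_equality)
    show "1 \<le> 1 + (Suc m - 1) * (Suc n - 1) \<and> ramsey_arrow (1 + (Suc m - 1) * (Suc n - 1))
      [(H, \<Gamma>), (mono_path (Suc n), trivial_perm_group (gverts (mono_path (Suc n))))]"
      using ramsey_arrow_graph_mono_path[of H m \<Gamma> n] assms mn by simp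
  next
    fix N
    assume "1 \<le> N \<and> ramsey_arrow N
      [(H, \<Gamma>), (mono_path (Suc n), trivial_perm_group (gverts (mono_path (Suc n))))]"
    then have "\<not> N \<le> m * n"
      using not_ramsey_arrow_connected_mono_path[of H m \<Gamma> N n] assms(4-6) mn by blast
    then show "1 + (Suc m - 1) * (Suc n - 1) \<le> N"
      by simp
  qed
qed

end
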